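(* For each integer $k>0$, the group $$P_k=\langle a, b \mid ab^{2^k}a^{-1}b^{2^k},\; ba^2b^{-1}a^2 \rangle$$ contains arbitrarily large non-unique product sets; that is, for every natural number $N$ there is a non-unique product set $S\subset P_k$ with $|S|\geq N$.
   Context: For a group $G$, a non-empty finite subset $S\subset G$ is called a non-unique product set if the product set $SS=\{st \mid s,t\in S\}$ has no uniquely represented element, i.e. for every $z\in SS$ there are at least two distinct pairs $(s,t)\in S\times S$ with $z=st$. *)

theory Defs
  imports "HOL-Algebra.Algebra"
begin

text \<open>
  A letter \<open>(x, e)\<close> stands for \<open>x\<close> if \<open>e\<close> is true and for the formal inverse of \<open>x\<close> otherwise.
  The free group on the (whole) type \<open>'a\<close> consists of the words modulo the equivalence relation
  generated by inserting or deleting a letter next to its formal inverse.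
\<close>

type_synonym 'a word = "('a \<times> bool) list"

inductive_set word_eq :: "('a word \<times> 'a word) set" where
  refl: "(u, u) \<in> word_eq"
| sym: "(u, v) \<in> word_eq \<Longrightarrow> (v, u) \<in> word_eq"
| trans: "(u, v) \<in> word_eq \<Longrightarrow> (v, w) \<in> word_eq \<Longrightarrow> (u, w) \<in> word_eq"
| cancel: "(u @ [(x, e), (x, \<not> e)] @ v, u @ v) \<in> word_eq"

definition free_group :: "'a word set monoid" where
  "free_group =
    \<lparr>carrier = UNIV // word_eq,
     monoid.mult = (\<lambda>U V. \<Union>u\<in>U. \<Union>v\<in>V. word_eq `` {u @ v}),
     one = word_eq `` {[]}\<rparr>"

definition free_gen :: "'a \<Rightarrow> 'a word set" where
  "free_gen x = word_eq `` {[(x, True)]}"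

definition normal_closure :: "('g, 'm) monoid_scheme \<Rightarrow> 'g set \<Rightarrow> 'g set" where
  "normal_closure G R = \<Inter>{N. N \<lhd> G \<and> R \<subseteq> N}"

definition presented_group :: "'a word set set \<Rightarrow> 'a word set set monoid" where
  "presented_group R = free_group Mod (normal_closure free_group R)"

datatype gen = A | B

definition P :: "nat \<Rightarrow> gen word set set monoid" where
  "P k =
    (let F = free_group; a = free_gen A; b = free_gen B
     in presented_group
       {a \<otimes>\<^bsub>F\<^esub> b [^]\<^bsub>F\<^esub> ((2::nat) ^ k) \<otimes>\<^bsub>F\<^esub> inv\<^bsub>F\<^esub> a \<otimes>\<^bsub>F\<^esub> b [^]\<^bsub>F\<^esub> ((2::nat) ^ k),
        b \<otimes>\<^bsub>F\<^esub> a [^]\<^bsub>F\<^esub> (2::nat) \<otimes>\<^bsub>F\<^esub> inv\<^bsub>F\<^esub> b \<otimes>\<^bsub>F\<^esub> a [^]\<^bsub>F\<^esub> (2::nat)})"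

definition non_unique_product_set :: "('g, 'm) monoid_scheme \<Rightarrow> 'g set \<Rightarrow> bool" where
  "non_unique_product_set G S \<longleftrightarrow>
     S \<subseteq> carrier G \<and> finite S \<and> S \<noteq> {} \<and>
     (\<forall>z \<in> S <#>\<^bsub>G\<^esub> S. \<exists>s\<in>S. \<exists>t\<in>S. \<exists>s'\<in>S. \<exists>t'\<in>S.
        (s, t) \<noteq> (s', t') \<and> z = s \<otimes>\<^bsub>G\<^esub> t \<and> z = s' \<otimes>\<^bsub>G\<^esub> t')"

lemma equiv_word_eq: "equiv UNIV word_eq"
  by (rule equivI) (auto simp: refl_on_def sym_def trans_def intro: word_eq.intros)

lemma word_eq_append_left: "(u, v) \<in> word_eq \<Longrightarrow> (w @ u, w @ v) \<in> word_eq"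
proof (induction rule: word_eq.induct)
  case (cancel u x e v)
  then show ?case using word_eq.cancel[of "w @ u" x e v] by simp
qed (auto intro: word_eq.intros)

lemma word_eq_append_right: "(u, v) \<in> word_eq \<Longrightarrow> (u @ w, v @ w) \<in> word_eq"
proof (induction rule: word_eq.induct)
  case (cancel u x e v)
  then show ?case using word_eq.cancel[of u x e "v @ w"] by simp
qed (auto intro: word_eq.intros)

lemma congruent2_append: "congruent2 word_eq word_eq (\<lambda>u v. word_eq `` {u @ v})"
proof (rule congruent2I')
  fix u u' v v' :: "'a word"
  assume "(u, u') \<in> word_eq" "(v, v') \<in> word_eq"
  then have "(u @ v, u' @ v') \<in> word_eq"
    by (blast intro: word_eq.trans word_eq_append_left word_eq_append_right)
  then show "word_eq `` {u @ v} = word_eq `` {u' @ v'}"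
    by (rule equiv_class_eq[OF equiv_word_eq])
qed

lemma free_group_carrierE:
  assumes "U \<in> carrier free_group" obtains u where "U = word_eq `` {u}"
  using assms by (auto simp: free_group_def elim: quotientE)

lemma free_group_carrierI: "word_eq `` {u} \<in> carrier free_group"
  by (auto simp: free_group_def intro: quotientI)

lemma free_group_mult: "word_eq `` {u} \<otimes>\<^bsub>free_group\<^esub> word_eq `` {v} = word_eq `` {u @ v}"
  unfolding free_group_def
  using UN_equiv_class2[OF equiv_word_eq equiv_word_eq congruent2_append] by simp

lemma free_group_one: "\<one>\<^bsub>free_group\<^esub> = word_eq `` {[]}"
  by (simp add: free_group_def)

definition word_inv :: "'a word \<Rightarrow> 'a word" where
  "word_inv w = rev (map (\<lambda>(x, e). (x, \<not> e)) w)"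

lemma word_inv_append: "(word_inv w @ w, []) \<in> word_eq"
proof (induction w)
  case Nil
  then show ?case by (simp add: word_inv_def word_eq.refl)
next
  case (Cons p w)
  obtain x e where p: "p = (x, e)" by force
  have "(word_inv w @ [(x, \<not> e), (x, \<not> \<not> e)] @ w, word_inv w @ w) \<in> word_eq"
    by (rule word_eq.cancel)
  then show ?case
    using Cons.IH by (auto simp: p word_inv_def intro: word_eq.trans)
qed

lemma group_free_group: "group (free_group :: 'a word set monoid)"
proof (rule groupI)
  fix U :: "'a word set"
  assume "U \<in> carrier free_group"
  then obtain u where u: "U = word_eq `` {u}" by (rule free_group_carrierE)
  have "word_eq `` {word_inv u @ u} = word_eq `` {[]}"
    using word_inv_append by (rule equiv_class_eq[OF equiv_word_eq])
  then show "\<exists>V\<in>carrier free_group. V \<otimes>\<^bsub>free_group\<^esub> U = \<one>\<^bsub>free_group\<^esub>"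
    using free_group_carrierI by (auto simp: u free_group_mult free_group_one intro!: bexI)
qed (auto elim!: free_group_carrierE simp: free_group_mult free_group_one free_group_carrierI)

lemma free_gen_closed: "free_gen x \<in> carrier free_group"
  by (simp add: free_gen_def free_group_carrierI)

lemma (in group) normal_normal_closure:
  assumes "R \<subseteq> carrier G"
  shows "normal_closure G R \<lhd> G"
  unfolding normal_inv_iff
proof (intro conjI ballI)
  have "{N. N \<lhd> G \<and> R \<subseteq> N} \<noteq> {}"
    using assms normal_self by blast
  then show "subgroup (normal_closure G R) G"
    unfolding normal_closure_def
    by (intro subgroups_Inter) (auto dest: normal_imp_subgroup)
  show "x \<otimes> h \<otimes> inv x \<in> normal_closure G R"
    if "x \<in> carrier G" "h \<in> normal_closure G R" for x h
    using that by (auto simp: normal_closure_def normal_inv_iff)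
qed

lemma group_presented_group:
  assumes "R \<subseteq> carrier free_group"
  shows "group (presented_group R)"
  unfolding presented_group_def
  by (intro normal.factorgroup_is_group group.normal_normal_closure group_free_group assms)

lemma group_P: "group (P k)"
proof -
  interpret F: group "free_group :: gen word set monoid" by (rule group_free_group)
  show ?thesis
    unfolding P_def Let_def by (rule group_presented_group) (auto simp: free_gen_closed)
qed

definition letter_eval :: "('g, 'm) monoid_scheme \<Rightarrow> ('a \<Rightarrow> 'g) \<Rightarrow> 'a \<times> bool \<Rightarrow> 'g" where
  "letter_eval G f p = (if snd p then f (fst p) else inv\<^bsub>G\<^esub> (f (fst p)))"

definition word_eval :: "('g, 'm) monoid_scheme \<Rightarrow> ('a \<Rightarrow> 'g) \<Rightarrow> 'a word \<Rightarrow> 'g" where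
  "word_eval G f w = foldr (\<lambda>p g. letter_eval G f p \<otimes>\<^bsub>G\<^esub> g) w \<one>\<^bsub>G\<^esub>"

lemma (in group) letter_eval_closed:
  "range f \<subseteq> carrier G \<Longrightarrow> letter_eval G f p \<in> carrier G"
  by (auto simp: letter_eval_def)

lemma (in group) word_eval_closed:
  "range f \<subseteq> carrier G \<Longrightarrow> word_eval G f w \<in> carrier G"
  by (induction w) (auto simp: word_eval_def letter_eval_closed)

lemma (in group) word_eval_append:
  assumes "range f \<subseteq> carrier G"
  shows "word_eval G f (u @ v) = word_eval G f u \<otimes> word_eval G f v"
proof (induction u)
  case Nil
  then show ?case using word_eval_closed[OF assms] by (simp add: word_eval_def)
next
  case (Cons p u)
  then show ?case
    using word_eval_closed[OF assms] letter_eval_closed[OF assms]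
    by (simp add: word_eval_def m_assoc)
qed

lemma (in group) word_eval_cong:
  assumes "(u, v) \<in> word_eq" "range f \<subseteq> carrier G"
  shows "word_eval G f u = word_eval G f v"
  using assms(1)
proof (induction rule: word_eq.induct)
  case (cancel u x e v)
  have "f x \<in> carrier G" using assms(2) by blast
  then have "word_eval G f [(x, e), (x, \<not> e)] = \<one>"
    by (simp add: word_eval_def letter_eval_def)
  then show ?case
    using word_eval_closed[OF assms(2)]
    by (simp only: word_eval_append[OF assms(2)]) simp
qed auto

lemma (in group) free_group_lift:
  fixes f :: "'x \<Rightarrow> 'a"
  assumes "range f \<subseteq> carrier G"
  obtains h where "h \<in> hom free_group G" "\<And>x. h (free_gen x) = f x"
proof
  define h :: "'x word set \<Rightarrow> 'a" where "h U = word_eval G f (SOME u. u \<in> U)" for U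
  have h: "h (word_eq `` {u}) = word_eval G f u" for u
  proof -
    have "(SOME v. v \<in> word_eq `` {u}) \<in> word_eq `` {u}"
      by (rule someI[of _ u]) (simp add: word_eq.refl)
    then show ?thesis
      unfolding h_def using word_eval_cong[OF _ assms] by auto
  qed
  show "h \<in> hom free_group G"
    by (rule homI)
      (auto elim!: free_group_carrierE
        simp: free_group_mult h word_eval_append[OF assms] word_eval_closed[OF assms])
  have "f x \<in> carrier G" for x using assms by blast
  then show "h (free_gen x) = f x" for x
    by (simp add: free_gen_def h word_eval_def letter_eval_def)
qed

end

theory Submission
  imports Defs
begin

text \<open>
  Put \<open>m = 2 ^ k\<close>, \<open>x = a\<^sup>2\<close> and \<open>y = b ^ m\<close>. The relators say that \<open>a\<close> inverts \<open>y\<close> and that \<open>b\<close>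
  inverts \<open>x\<close>; since \<open>m\<close> is even, \<open>x\<close> and \<open>y\<close> commute. The group is thus glued from the two Klein
  bottle groups \<open>\<langle>a, y\<rangle>\<close> and \<open>\<langle>b, x\<rangle>\<close> along \<open>\<langle>x, y\<rangle>\<close>. Each of them on its own has unique products, and
  the construction lets each one supply the second factorisations that the other one lacks.

  In \<open>\<langle>a, x, y\<rangle>\<close>, multiply \<open>{1, x y, a, y a}\<close> by \<open>{1, x y\<^sup>-\<^sup>1, a, y a}\<close>. Because \<open>a\<close> inverts \<open>y\<close>,
  the sixteen products coincide in pairs (for instance \<open>a a = (y a) (y a) = x\<close>), except for
  \<open>1 \<cdot> 1 = 1\<close> and \<open>(x y) (x y\<^sup>-\<^sup>1) = x\<^sup>2\<close> (lemma \<open>core_exchange\<close>).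

  To repair the two exceptions, multiply from the left by elements \<open>b\<^sup>i x\<^sup>u\<close> and from the right by
  elements \<open>x\<^sup>v b\<^sup>j\<close>, with \<open>u, v\<close> in \<open>{-1, 0}\<close>. An exceptional product becomes \<open>b\<^sup>i x\<^sup>w b\<^sup>j\<close>, with \<open>w\<close> either
  \<open>u + v\<close> or \<open>u + v + 2\<close>. If \<open>u = v\<close>, moving one \<open>b\<close> across \<open>x\<^sup>w\<close> changes the sign of \<open>w\<close>, and this turns
  a product with middle part \<open>1\<close> into one with middle part \<open>x\<^sup>2\<close> and conversely. If
  \<open>u \<noteq> v\<close>, then \<open>w = \<plusminus>1\<close>, and the same element arises from \<open>u = v\<close> and a middle part \<open>x\<close>, \<open>x y\<close>
  or \<open>x y\<^sup>-\<^sup>1\<close>: the factor \<open>y\<^sup>\<plusminus>\<^sup>1 = b\<^sup>\<plusminus>\<^sup>m\<close> brings an exponent of \<open>b\<close> back into its range when it falls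
  off the end. This gives finite sets \<open>L\<close> and \<open>R\<close> such that every product in \<open>L R\<close> can be
  refactored with a different left factor (lemma \<open>factor_exchange\<close>).

  Finally, \<open>R Z L\<close> is a non-unique product set for every finite non-empty \<open>Z\<close>, as the refactoring
  can be done at the junction \<open>L R\<close> in the middle of \<open>(R Z L) (R Z L)\<close>. Its size is at least
  that of \<open>Z\<close>, and \<open>b\<close> has infinite order. All inequalities between group elements are certified by an
  action on the integers, with \<open>a\<close> as a reflection and \<open>b\<close> as a translation, which detects the parity of
  \<open>a\<close> and, for a fixed parity, the position of the translation part.
\<close>

section \<open>Amplifying a product without unique factorisations\<close>

text \<open>
  The set is \<open>R Z L\<close>. In \<open>(\<beta> z \<alpha>) (\<beta>1 z1 \<alpha>1)\<close> the inner product \<open>\<alpha> \<beta>1\<close> can be replaced by \<open>\<alpha>' \<beta>'\<close>, which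
  changes the first factor because \<open>\<alpha>' \<noteq> \<alpha>\<close>. A condition on a pair of sets is thereby converted
  into one on a single set, with \<open>Z\<close> free to be as large as desired.
\<close>

lemma (in group) non_unique_product_set_sandwich:
  assumes L: "L \<subseteq> carrier G" "finite L" "L \<noteq> {}"
    and R: "R \<subseteq> carrier G" "finite R" "R \<noteq> {}"
    and Z: "Z \<subseteq> carrier G" "finite Z" "Z \<noteq> {}"
    and exchange: "\<And>\<alpha> \<beta>. \<alpha> \<in> L \<Longrightarrow> \<beta> \<in> R \<Longrightarrow>
      \<exists>\<alpha>'\<in>L. \<exists>\<beta>'\<in>R. \<alpha>' \<otimes> \<beta>' = \<alpha> \<otimes> \<beta> \<and> \<alpha>' \<noteq> \<alpha>"
  shows "\<exists>S. non_unique_product_set G S \<and> card Z \<le> card S"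
proof -
  define S where "S = (\<lambda>(\<beta>, z, \<alpha>). \<beta> \<otimes> z \<otimes> \<alpha>) ` (R \<times> Z \<times> L)"
  have SI: "\<beta> \<otimes> z \<otimes> \<alpha> \<in> S" if "\<beta> \<in> R" "z \<in> Z" "\<alpha> \<in> L" for \<alpha> \<beta> z
    using that by (auto simp: S_def intro!: image_eqI[of _ _ "(\<beta>, z, \<alpha>)"])
  have fin: "finite S" using L R Z by (simp add: S_def)
  have two: "\<exists>s'\<in>S. \<exists>t'\<in>S. (s, t) \<noteq> (s', t') \<and> s \<otimes> t = s' \<otimes> t'"
    if st: "s \<in> S" "t \<in> S" for s t
  proof -
    obtain \<beta> z \<alpha> where s: "s = \<beta> \<otimes> z \<otimes> \<alpha>" "\<beta> \<in> R" "z \<in> Z" "\<alpha> \<in> L"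
      using st by (auto simp: S_def)
    obtain \<beta>1 z1 \<alpha>1 where t: "t = \<beta>1 \<otimes> z1 \<otimes> \<alpha>1" "\<beta>1 \<in> R" "z1 \<in> Z" "\<alpha>1 \<in> L"
      using st by (auto simp: S_def)
    obtain \<alpha>' \<beta>' where ex: "\<alpha>' \<in> L" "\<beta>' \<in> R" "\<alpha>' \<otimes> \<beta>' = \<alpha> \<otimes> \<beta>1" "\<alpha>' \<noteq> \<alpha>"
      using exchange[OF s(4) t(2)] by blast
    have cl: "\<beta> \<in> carrier G" "z \<in> carrier G" "\<alpha> \<in> carrier G" "\<beta>1 \<in> carrier G"
        "z1 \<in> carrier G" "\<alpha>1 \<in> carrier G" "\<alpha>' \<in> carrier G" "\<beta>' \<in> carrier G"
      using s t ex L R Z by auto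
    have "s \<otimes> t = (\<beta> \<otimes> z) \<otimes> (\<alpha> \<otimes> \<beta>1) \<otimes> (z1 \<otimes> \<alpha>1)"
      using cl by (simp add: s t m_assoc)
    also have "\<dots> = (\<beta> \<otimes> z) \<otimes> (\<alpha>' \<otimes> \<beta>') \<otimes> (z1 \<otimes> \<alpha>1)" by (simp add: ex)
    also have "\<dots> = (\<beta> \<otimes> z \<otimes> \<alpha>') \<otimes> (\<beta>' \<otimes> z1 \<otimes> \<alpha>1)"
      using cl by (simp add: m_assoc)
    finally have "s \<otimes> t = (\<beta> \<otimes> z \<otimes> \<alpha>') \<otimes> (\<beta>' \<otimes> z1 \<otimes> \<alpha>1)" .
    moreover have "s \<noteq> \<beta> \<otimes> z \<otimes> \<alpha>'" using cl ex(4) by (simp add: s)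
    ultimately show ?thesis
      using SI[OF s(2,3) ex(1)] SI[OF ex(2) t(3,4)] by blast
  qed
  have "non_unique_product_set G S"
    unfolding non_unique_product_set_def
  proof (intro conjI ballI)
    show "S \<subseteq> carrier G" using L(1) R(1) Z(1) by (auto simp: S_def intro!: m_closed)
    show "finite S" by (rule fin)
    show "S \<noteq> {}" using L R Z by (simp add: S_def)
    fix z assume "z \<in> S <#> S"
    then obtain s t where "s \<in> S" "t \<in> S" "z = s \<otimes> t" by (auto simp: set_mult_def)
    then show "\<exists>s\<in>S. \<exists>t\<in>S. \<exists>s'\<in>S. \<exists>t'\<in>S.
        (s, t) \<noteq> (s', t') \<and> z = s \<otimes> t \<and> z = s' \<otimes> t'"
      using two by blast
  qed
  moreover have "card Z \<le> card S"
  proof -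
    obtain \<alpha> \<beta> where ab: "\<alpha> \<in> L" "\<beta> \<in> R" using L R by blast
    have "inj_on (\<lambda>z. \<beta> \<otimes> z \<otimes> \<alpha>) Z"
      using ab L R Z by (intro inj_onI) (simp add: subset_iff)
    moreover have "(\<lambda>z. \<beta> \<otimes> z \<otimes> \<alpha>) ` Z \<subseteq> S" using SI ab by blast
    ultimately show ?thesis using card_inj_on_le fin by blast
  qed
  ultimately show ?thesis by blast
qed

section \<open>Two Klein bottle relations\<close>

lemma (in group) conj_int_pow:
  assumes [simp]: "g \<in> carrier G" "h \<in> carrier G"
  shows "g \<otimes> h [^] (n::int) \<otimes> inv g = (g \<otimes> h \<otimes> inv g) [^] n"
proof -
  interpret c: group_hom G G "\<lambda>z. g \<otimes> z \<otimes> inv g"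
    by unfold_locales (auto intro!: homI simp: m_assoc inv_solve_left)
  show ?thesis by (rule c.hom_int_pow) simp
qed

text \<open>Both relators have the shape \<open>g h g\<^sup>-\<^sup>1 h\<close>, so conjugation by \<open>g\<close> acts on powers of \<open>h\<close> as inversion.\<close>

lemma (in group) inverting_int_pow:
  assumes [simp]: "g \<in> carrier G" "h \<in> carrier G" and rel: "g \<otimes> h \<otimes> inv g \<otimes> h = \<one>"
  shows "g \<otimes> h [^] (n::int) = h [^] (- n) \<otimes> g"
proof -
  have "g \<otimes> h \<otimes> inv g = inv h"
    using rel by (metis assms(1,2) inv_closed inv_equality inv_inv m_closed)
  then have "g \<otimes> h [^] n \<otimes> inv g = h [^] (- n)"
    using conj_int_pow[of g h n] by (simp add: int_pow_inv int_pow_neg)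
  then show ?thesis
    by (metis assms(1,2) int_pow_closed inv_solve_right m_closed)
qed

text \<open>
  The relators of the presented groups, with any even number \<open>m \<ge> 2\<close> as the exponent of \<open>b\<close>. The map \<open>\<phi>\<close> is
  an action on the integers whose purpose is to certify that elements are distinct.
\<close>

locale klein_amalgam = group G for G (structure) +
  fixes a b :: 'a and m :: nat and \<phi> :: "'a \<Rightarrow> int \<Rightarrow> int"
  assumes a_closed [simp]: "a \<in> carrier G" and b_closed [simp]: "b \<in> carrier G"
    and m_even: "even m" and m_ge: "2 \<le> m"
    and rel_ab: "a \<otimes> b [^] m \<otimes> inv a \<otimes> b [^] m = \<one>"
    and rel_ba: "b \<otimes> a [^] (2::nat) \<otimes> inv b \<otimes> a [^] (2::nat) = \<one>"
    and \<phi>_mult: "\<And>g h. g \<in> carrier G \<Longrightarrow> h \<in> carrier G \<Longrightarrow> \<phi> (g \<otimes> h) = \<phi> g \<circ> \<phi> h"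
    and \<phi>_a: "\<phi> a = (\<lambda>t. - t)" and \<phi>_b: "\<phi> b = (\<lambda>t. t + 1)"
begin

definition "x = a [^] (2::nat)"
definition "y = b [^] m"

lemma x_closed [simp]: "x \<in> carrier G" and y_closed [simp]: "y \<in> carrier G"
  by (simp_all add: x_def y_def)

lemma aa: "a \<otimes> a = x" by (simp add: x_def numeral_2_eq_2)

lemma ax: "a \<otimes> x = x \<otimes> a" by (simp add: m_assoc flip: aa)

lemma ay: "a \<otimes> y [^] n = y [^] (- n) \<otimes> a" for n :: int
  using rel_ab by (intro inverting_int_pow) (simp_all add: y_def)

lemma bx: "b \<otimes> x [^] n = x [^] (- n) \<otimes> b" for n :: int
  using rel_ba by (intro inverting_int_pow) (simp_all add: x_def)

lemma b_pow_x:
  "b [^] i \<otimes> x [^] n = x [^] (if even i then n else - n) \<otimes> b [^] i" for i :: nat and n :: int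
proof (induction i arbitrary: n)
  case (Suc i)
  have "b [^] Suc i \<otimes> x [^] n = b [^] i \<otimes> (b \<otimes> x [^] n)" by (simp add: m_assoc)
  also have "\<dots> = (b [^] i \<otimes> x [^] (- n)) \<otimes> b" unfolding bx by (simp add: m_assoc)
  also have "\<dots> = x [^] (if even i then - n else - (- n)) \<otimes> b [^] Suc i"
    unfolding Suc.IH by (simp add: m_assoc)
  finally show ?case by simp
qed simp

text \<open>This is where the parity of \<open>m\<close> enters: an even number of sign changes cancels.\<close>

lemma yx: "y \<otimes> x [^] n = x [^] n \<otimes> y" for n :: int
  using b_pow_x[of m n] m_even by (simp add: y_def)

lemma y_pow_x: "y [^] s \<otimes> x [^] n = x [^] n \<otimes> y [^] s" for s n :: int
proof -
  have "x [^] n \<otimes> y \<otimes> inv (x [^] n) = y"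
    by (simp add: m_assoc flip: yx)
  then have "x [^] n \<otimes> y [^] s \<otimes> inv (x [^] n) = y [^] s"
    by (simp add: conj_int_pow)
  then show ?thesis
    by (simp add: inv_solve_right')
qed

lemma y_pow: "y [^] s = b [^] (int m * s)" for s :: int
  by (simp add: y_def int_pow_pow flip: int_pow_int)

text \<open>
  The products to be refactored have the form \<open>bxb i w j\<close>. A single step of \<open>b\<close> moves across at the cost
  of the sign of \<open>w\<close>, whereas \<open>m\<close> steps move across for free.
\<close>

definition bxb :: "int \<Rightarrow> int \<Rightarrow> int \<Rightarrow> 'a" where
  "bxb i w j = b [^] i \<otimes> x [^] w \<otimes> b [^] j"

lemma bxb_shift: "bxb (i + 1) w j = bxb i (- w) (j + 1)"
proof -
  have "bxb (i + 1) w j = b [^] i \<otimes> (b \<otimes> x [^] w) \<otimes> b [^] j"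
    by (simp add: bxb_def int_pow_mult m_assoc)
  also have "\<dots> = b [^] i \<otimes> x [^] (- w) \<otimes> (b \<otimes> b [^] j)"
    unfolding bx by (simp add: m_assoc)
  also have "b \<otimes> b [^] j = b [^] (j + 1)"
    by (simp add: add.commute[of j] int_pow_mult)
  finally show ?thesis by (simp add: bxb_def)
qed

lemma bxb_wrap: "bxb (i + int m) w j = bxb i w (j + int m)"
proof -
  have y1: "b [^] int m = y" by (simp add: y_def int_pow_int)
  have "bxb (i + int m) w j = b [^] i \<otimes> (y \<otimes> x [^] w) \<otimes> b [^] j"
    by (simp add: bxb_def int_pow_mult m_assoc y1)
  also have "\<dots> = b [^] i \<otimes> x [^] w \<otimes> (y \<otimes> b [^] j)"
    unfolding yx by (simp add: m_assoc)
  also have "y \<otimes> b [^] j = b [^] (j + int m)"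
    by (simp add: add.commute[of j] int_pow_mult y1)
  finally show ?thesis by (simp add: bxb_def)
qed

lemma factors_mult:
  fixes i j u v t s :: int
  assumes [simp]: "e \<in> carrier G" "f \<in> carrier G" and ef: "e \<otimes> f = x [^] t \<otimes> y [^] s"
  shows "(b [^] i \<otimes> x [^] u \<otimes> e) \<otimes> (f \<otimes> x [^] v \<otimes> b [^] j) = bxb i (u + t + v) (j + int m * s)"
proof -
  have "(b [^] i \<otimes> x [^] u \<otimes> e) \<otimes> (f \<otimes> x [^] v \<otimes> b [^] j) =
      b [^] i \<otimes> x [^] u \<otimes> (e \<otimes> f) \<otimes> x [^] v \<otimes> b [^] j"
    by (simp add: m_assoc)
  also have "\<dots> = b [^] i \<otimes> x [^] u \<otimes> x [^] t \<otimes> (y [^] s \<otimes> x [^] v) \<otimes> b [^] j"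
    by (simp add: ef m_assoc)
  also have "\<dots> = b [^] i \<otimes> (x [^] u \<otimes> x [^] t \<otimes> x [^] v) \<otimes> (y [^] s \<otimes> b [^] j)"
    unfolding y_pow_x by (simp add: m_assoc)
  also have "y [^] s \<otimes> b [^] j = b [^] (j + int m * s)"
    by (simp add: y_pow add.commute[of j] int_pow_mult)
  finally show ?thesis by (simp add: bxb_def int_pow_mult)
qed

lemma \<phi>_one: "\<phi> \<one> = id"
proof
  fix t
  have "\<phi> b t = \<phi> b (\<phi> \<one> t)" using \<phi>_mult[of b \<one>] by (simp add: fun_eq_iff)
  then show "\<phi> \<one> t = id t" by (simp add: \<phi>_b)
qed

lemma \<phi>_translation_pow:
  assumes [simp]: "g \<in> carrier G" and g: "\<phi> g = (\<lambda>t. t + c)"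
  shows "\<phi> (g [^] (n::int)) = (\<lambda>t. t + n * c)"
proof -
  have nat: "\<phi> (g [^] k) = (\<lambda>t. t + int k * c)" for k :: nat
    by (induction k) (auto simp: \<phi>_one \<phi>_mult g fun_eq_iff algebra_simps)
  show ?thesis
  proof (cases n)
    case (nonneg k)
    then show ?thesis by (simp add: int_pow_int nat)
  next
    case (neg k)
    have "\<phi> (g [^] Suc k) (\<phi> (g [^] n) t) = t" for t
    proof -
      have "g [^] Suc k \<otimes> g [^] n = \<one>"
        unfolding neg int_pow_neg_int[OF assms(1)] by (rule r_inv) simp
      then show ?thesis
        using \<phi>_mult[of "g [^] Suc k" "g [^] n"] by (simp add: \<phi>_one fun_eq_iff)
    qed
    then show ?thesis
      unfolding nat neg by (simp add: fun_eq_iff algebra_simps eq_diff_eq)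
  qed
qed

lemma \<phi>_x_pow: "\<phi> (x [^] u) = id" for u :: int
  using \<phi>_translation_pow[of x 0 u] by (simp add: \<phi>_mult \<phi>_a fun_eq_iff flip: aa)

lemma \<phi>_b_pow: "\<phi> (b [^] i) = (\<lambda>t. t + i)" for i :: int
  using \<phi>_translation_pow[of b 1 i] by (simp add: \<phi>_b)

lemma \<phi>_x: "\<phi> x = id" and \<phi>_y: "\<phi> y = (\<lambda>t. t + int m)"
  using \<phi>_x_pow[of 1] \<phi>_b_pow[of "int m"] by (simp_all add: y_def int_pow_int)

section \<open>A pair of sets whose products can be refactored\<close>

text \<open>
  With \<open>\<sigma>\<close> for the inversion of \<open>y\<close> that \<open>a\<close> induces, the two sets are \<open>p + q a\<close> and \<open>\<sigma>(p) + q a\<close> for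
  \<open>p = {1, x y}\<close> and \<open>q = {1, y}\<close>. This choice makes all products containing exactly one \<open>a\<close> come in
  pairs, since \<open>p q a\<close> is obtained as \<open>p (q a)\<close> and as \<open>(q a) \<sigma>(p)\<close>.
\<close>

definition "left_core = {\<one>, x \<otimes> y, a, y \<otimes> a}"
definition "right_core = {\<one>, x \<otimes> inv y, a, y \<otimes> a}"

lemma left_core_closed: "e \<in> left_core \<Longrightarrow> e \<in> carrier G"
  and right_core_closed: "f \<in> right_core \<Longrightarrow> f \<in> carrier G"
  by (auto simp: left_core_def right_core_def)

lemma a_inv_y: "a \<otimes> inv y = y \<otimes> a" and a_y: "a \<otimes> y = inv y \<otimes> a"
  using ay[of "-1"] ay[of 1] by (simp_all add: int_pow_neg)

lemma xy: "y \<otimes> x = x \<otimes> y" using yx[of 1] by simp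

lemma core_products:
  "a \<otimes> a = x" "(y \<otimes> a) \<otimes> (y \<otimes> a) = x"
  "a \<otimes> (y \<otimes> a) = x \<otimes> inv y" "(y \<otimes> a) \<otimes> a = x \<otimes> y"
  "(x \<otimes> y) \<otimes> a = a \<otimes> (x \<otimes> inv y)"
  "(x \<otimes> y) \<otimes> (y \<otimes> a) = (y \<otimes> a) \<otimes> (x \<otimes> inv y)"
  "(x \<otimes> y) \<otimes> (x \<otimes> inv y) = x [^] (2::int)"
proof -
  have inv_y_x: "inv y \<otimes> x = x \<otimes> inv y" using y_pow_x[of "-1" 1] by (simp add: int_pow_neg)
  show "a \<otimes> a = x" by (rule aa)
  have aya: "a \<otimes> (y \<otimes> a) = inv y \<otimes> x"
  proof -
    have "a \<otimes> (y \<otimes> a) = inv y \<otimes> a \<otimes> a" by (simp add: a_y flip: m_assoc)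
    then show ?thesis by (simp add: m_assoc aa)
  qed
  then show "a \<otimes> (y \<otimes> a) = x \<otimes> inv y" by (simp only: inv_y_x)
  have "(y \<otimes> a) \<otimes> (y \<otimes> a) = y \<otimes> (inv y \<otimes> x)" by (simp add: m_assoc aya)
  also have "\<dots> = y \<otimes> inv y \<otimes> x" by (simp only: m_assoc y_closed inv_closed x_closed)
  finally show "(y \<otimes> a) \<otimes> (y \<otimes> a) = x" by simp
  show "(y \<otimes> a) \<otimes> a = x \<otimes> y" by (simp add: m_assoc aa xy)
  have axy: "a \<otimes> (x \<otimes> inv y) = x \<otimes> y \<otimes> a"
  proof -
    have "a \<otimes> (x \<otimes> inv y) = x \<otimes> a \<otimes> inv y" by (simp add: ax flip: m_assoc)
    then show ?thesis by (simp add: m_assoc a_inv_y)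
  qed
  then show "(x \<otimes> y) \<otimes> a = a \<otimes> (x \<otimes> inv y)" by simp
  have "(y \<otimes> a) \<otimes> (x \<otimes> inv y) = (y \<otimes> x) \<otimes> (y \<otimes> a)" by (simp add: m_assoc axy)
  then show "(x \<otimes> y) \<otimes> (y \<otimes> a) = (y \<otimes> a) \<otimes> (x \<otimes> inv y)" by (simp only: xy)
  have "(x \<otimes> y) \<otimes> (x \<otimes> inv y) = x \<otimes> (y \<otimes> x) \<otimes> inv y" by (simp add: m_assoc)
  also have "\<dots> = x \<otimes> x \<otimes> (y \<otimes> inv y)" 
    unfolding xy by (simp only: m_assoc m_closed y_closed inv_closed x_closed)
  also have "\<dots> = x [^] (2::int)" using int_pow_mult[of x 1 1] by simp
  finally show "(x \<otimes> y) \<otimes> (x \<otimes> inv y) = x [^] (2::int)" .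
qed

text \<open>
  The exceptional products are \<open>1\<close> and \<open>x\<^sup>2\<close>. In every other case the two left factors differ in the parity
  of \<open>a\<close>, or they are \<open>a\<close> and \<open>y a\<close>; the action tells them apart.
\<close>

lemma core_exchange:
  assumes "e \<in> left_core" "f \<in> right_core"
  obtains (one) "e = \<one>" "f = \<one>" | (square) "e = x \<otimes> y" "f = x \<otimes> inv y"
  | (swap) e' f' where "e' \<in> left_core" "f' \<in> right_core" "e' \<otimes> f' = e \<otimes> f" "\<phi> e' \<noteq> \<phi> e"
proof -
  have neI: "\<phi> g \<noteq> \<phi> h" if "\<phi> g 0 \<noteq> \<phi> h 0 \<or> \<phi> g 1 \<noteq> \<phi> h 1" for g h
    using that by auto
  have ne: "\<phi> a \<noteq> \<phi> \<one>" "\<phi> (y \<otimes> a) \<noteq> \<phi> \<one>" "\<phi> (x \<otimes> y) \<noteq> \<phi> a" "\<phi> (x \<otimes> y) \<noteq> \<phi> (y \<otimes> a)"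
      "\<phi> a \<noteq> \<phi> (y \<otimes> a)"
    by (rule neI; use m_ge in \<open>simp add: \<phi>_one \<phi>_x \<phi>_y \<phi>_mult \<phi>_a\<close>)+
  consider "e = \<one>" "f = \<one>" | "e = \<one>" "f = x \<otimes> inv y" | "e = \<one>" "f = a \<or> f = y \<otimes> a"
    | "e = x \<otimes> y" "f = \<one>" | "e = x \<otimes> y" "f = x \<otimes> inv y" | "e = x \<otimes> y" "f = a \<or> f = y \<otimes> a"
    | "e = a \<or> e = y \<otimes> a" "f = \<one>" | "e = a \<or> e = y \<otimes> a" "f = x \<otimes> inv y"
    | "e = a" "f = a" | "e = a" "f = y \<otimes> a" | "e = y \<otimes> a" "f = a" | "e = y \<otimes> a" "f = y \<otimes> a"
    using assms unfolding left_core_def right_core_def by (elim insertE emptyE; blast)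
  then show thesis
  proof cases
    case 1 then show ?thesis by (rule one)
  next
    case 2 then show ?thesis
      by (intro swap[of a "y \<otimes> a"]) (use ne in \<open>auto simp: left_core_def right_core_def core_products\<close>)
  next
    case 3 then show ?thesis
      by (intro swap[of f \<one>]) (use ne in \<open>auto simp: left_core_def right_core_def\<close>)
  next
    case 4 then show ?thesis
      by (intro swap[of "y \<otimes> a" a]) (use ne in \<open>auto simp: left_core_def right_core_def core_products\<close>)
  next
    case 5 then show ?thesis by (rule square)
  next
    case 6 then show ?thesis
      by (intro swap[of f "x \<otimes> inv y"]) (use ne in \<open>auto simp: left_core_def right_core_def core_products\<close>)
  next
    case 7 then show ?thesis
      by (intro swap[of \<one> e]) (use ne in \<open>auto simp: left_core_def right_core_def\<close>)
  next
    case 8 then show ?thesis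
      by (intro swap[of "x \<otimes> y" e]) (use ne in \<open>auto simp: left_core_def right_core_def core_products\<close>)
  next
    case 9 then show ?thesis
      by (intro swap[of "y \<otimes> a" "y \<otimes> a"]) (use ne in \<open>auto simp: left_core_def right_core_def core_products\<close>)
  next
    case 10 then show ?thesis
      by (intro swap[of \<one> "x \<otimes> inv y"]) (use ne in \<open>auto simp: left_core_def right_core_def core_products\<close>)
  next
    case 11 then show ?thesis
      by (intro swap[of "x \<otimes> y" \<one>]) (use ne in \<open>auto simp: left_core_def right_core_def core_products\<close>)
  next
    case 12 then show ?thesis
      by (intro swap[of a a]) (use ne in \<open>auto simp: left_core_def right_core_def core_products\<close>)
  qed
qed

text \<open>
  Since \<open>b\<^sup>i (x b) = b\<^sup>i\<^sup>+\<^sup>1 x\<^sup>-\<^sup>1\<close>, the left factor is \<open>{b\<^sup>i | 0 \<le> i < m} {1, x b} left_core\<close>, and similarly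
  the right factor is \<open>right_core {b, x\<^sup>-\<^sup>1} {b\<^sup>j | 0 \<le> j < m}\<close>. The offset of the exponent range by one
  between the two values of \<open>u\<close> lets the step \<open>i \<mapsto> i + 1\<close>, \<open>u \<mapsto> u - 1\<close> never leave the set,
  and likewise on the right; the length \<open>m\<close> lets \<open>y\<close> wrap one end of the range onto the other.
\<close>

definition "left_factor =
  {b [^] i \<otimes> x [^] u \<otimes> e | i u e.
    u \<in> {-1, 0} \<and> 0 \<le> i + u \<and> i + u < int m \<and> e \<in> left_core}"

definition "right_factor =
  {f \<otimes> x [^] v \<otimes> b [^] j | f v j.
    v \<in> {-1, 0} \<and> 0 \<le> j - 1 - v \<and> j - 1 - v < int m \<and> f \<in> right_core}"

lemma left_factor_finite: "finite left_factor"
proof (rule finite_subset)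
  show "left_factor \<subseteq> (\<lambda>(i, u::int, e). b [^] i \<otimes> x [^] u \<otimes> e) ` ({0..int m} \<times> {-1, 0} \<times> left_core)"
  proof
    fix \<alpha> assume "\<alpha> \<in> left_factor"
    then obtain i u :: int and e where "\<alpha> = b [^] i \<otimes> x [^] u \<otimes> e"
      "u \<in> {-1, 0}" "0 \<le> i + u" "i + u < int m" "e \<in> left_core"
      unfolding left_factor_def by blast
    then show "\<alpha> \<in> (\<lambda>(i, u::int, e). b [^] i \<otimes> x [^] u \<otimes> e) ` ({0..int m} \<times> {-1, 0} \<times> left_core)"
      by (intro rev_image_eqI[of "(i, u, e)"]) auto
  qed
qed (simp add: left_core_def)

lemma right_factor_finite: "finite right_factor"
proof (rule finite_subset)
  show "right_factor \<subseteq> (\<lambda>(f, v::int, j). f \<otimes> x [^] v \<otimes> b [^] j) ` (right_core \<times> {-1, 0} \<times> {0..int m})"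
  proof
    fix \<beta> assume "\<beta> \<in> right_factor"
    then obtain v j :: int and f where "\<beta> = f \<otimes> x [^] v \<otimes> b [^] j"
      "v \<in> {-1, 0}" "0 \<le> j - 1 - v" "j - 1 - v < int m" "f \<in> right_core"
      unfolding right_factor_def by blast
    then show "\<beta> \<in> (\<lambda>(f, v::int, j). f \<otimes> x [^] v \<otimes> b [^] j) ` (right_core \<times> {-1, 0} \<times> {0..int m})"
      by (intro rev_image_eqI[of "(f, v, j)"]) auto
  qed
qed (simp add: right_core_def)

lemma left_factor_closed: "left_factor \<subseteq> carrier G"
  and right_factor_closed: "right_factor \<subseteq> carrier G"
  by (auto simp: left_factor_def right_factor_def left_core_closed right_core_closed)

lemma factors_nonempty: "left_factor \<noteq> {}" "right_factor \<noteq> {}"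
proof -
  have "b [^] i \<otimes> x [^] u \<otimes> e \<in> left_factor"
    if "u = 0" "i = 0" "e = \<one>" for i u :: int and e
    unfolding left_factor_def mem_Collect_eq using that m_ge
    by (intro exI[of _ i] exI[of _ u] exI[of _ e]) (simp add: left_core_def)
  moreover have "f \<otimes> x [^] v \<otimes> b [^] j \<in> right_factor"
    if "v = 0" "j = 1" "f = \<one>" for v j :: int and f
    unfolding right_factor_def mem_Collect_eq using that m_ge
    by (intro exI[of _ f] exI[of _ v] exI[of _ j]) (simp add: right_core_def)
  ultimately show "left_factor \<noteq> {}" "right_factor \<noteq> {}" by blast+
qed

lemma \<phi>_left:
  "e \<in> carrier G \<Longrightarrow> \<phi> (b [^] i \<otimes> x [^] u \<otimes> e) = (\<lambda>t. \<phi> e t + i)" for i u :: int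
  by (simp add: \<phi>_mult \<phi>_b_pow \<phi>_x_pow fun_eq_iff)

text \<open>
  Pairs that are not exceptional in the core are exchanged there, with the outer exponents kept. The
  exceptional core products \<open>1\<close> and \<open>x\<^sup>2\<close> trade places when \<open>u = v\<close>, and are replaced by \<open>x y\<^sup>s\<close> with
  \<open>s \<in> {-1, 0, 1}\<close> when \<open>u \<noteq> v\<close>. In the latter case the new left factor contains an odd number of \<open>a\<close>,
  so it is new; in the former case the total exponent of \<open>b\<close> in it changes.
\<close>

lemma factor_exchange:
  assumes "\<alpha> \<in> left_factor" "\<beta> \<in> right_factor"
  shows "\<exists>\<alpha>'\<in>left_factor. \<exists>\<beta>'\<in>right_factor. \<alpha>' \<otimes> \<beta>' = \<alpha> \<otimes> \<beta> \<and> \<alpha>' \<noteq> \<alpha>"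
proof -
  obtain i u e where \<alpha>: "\<alpha> = b [^] i \<otimes> x [^] u \<otimes> e" and u: "u \<in> {-1, 0}"
    and i: "0 \<le> i + u" "i + u < int m" and e: "e \<in> left_core"
    using assms(1) by (auto simp: left_factor_def)
  obtain f v j where \<beta>: "\<beta> = f \<otimes> x [^] v \<otimes> b [^] j" and v: "v \<in> {-1, 0}"
    and j: "0 \<le> j - 1 - v" "j - 1 - v < int m" and f: "f \<in> right_core"
    using assms(2) by (auto simp: right_factor_def)
  note [simp] = left_core_closed[OF e] right_core_closed[OF f]
  \<comment> \<open>It suffices to evaluate the action at one integer \<open>t\<close> where the two left factors differ.\<close>
  have alternative: ?thesis
    if "u' \<in> {-1, 0}" "0 \<le> i' + u'" "i' + u' < int m" "e' \<in> left_core"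
      "v' \<in> {-1, 0}" "0 \<le> j' - 1 - v'" "j' - 1 - v' < int m" "f' \<in> right_core"
      "(b [^] i' \<otimes> x [^] u' \<otimes> e') \<otimes> (f' \<otimes> x [^] v' \<otimes> b [^] j') = \<alpha> \<otimes> \<beta>"
      "\<phi> e' t + i' \<noteq> \<phi> e t + i"
    for i' u' v' j' t :: int and e' f'
  proof (intro bexI conjI notI)
    show "b [^] i' \<otimes> x [^] u' \<otimes> e' \<in> left_factor" "f' \<otimes> x [^] v' \<otimes> b [^] j' \<in> right_factor"
      using that unfolding left_factor_def right_factor_def by blast+
    assume "b [^] i' \<otimes> x [^] u' \<otimes> e' = \<alpha>"
    then have "\<phi> (b [^] i' \<otimes> x [^] u' \<otimes> e') t = \<phi> \<alpha> t" by (rule arg_cong)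
    then show False using that(10) by (simp only: \<alpha> \<phi>_left left_core_closed[OF that(4)] left_core_closed[OF e])
  qed (rule that)
  have exch: ?thesis
    if "e' \<otimes> f' = x [^] t' \<otimes> y [^] s'" "e' \<in> left_core" "f' \<in> right_core"
      "u' \<in> {-1, 0}" "0 \<le> i' + u'" "i' + u' < int m"
      "v' \<in> {-1, 0}" "0 \<le> j' - 1 - v'" "j' - 1 - v' < int m"
      "bxb i' (u' + t' + v') (j' + int m * s') = \<alpha> \<otimes> \<beta>"
      "\<phi> e' t + i' \<noteq> \<phi> e t + i"
    for i' u' v' j' t t' s' :: int and e' f'
    using that factors_mult[OF left_core_closed[OF that(2)] right_core_closed[OF that(3)] that(1)]
    by (intro alternative[of u' i' e' v' j' f' t]) simp_all
  have p: "\<one> \<otimes> \<one> = x [^] (0::int) \<otimes> y [^] (0::int)"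
    "(x \<otimes> y) \<otimes> (x \<otimes> inv y) = x [^] (2::int) \<otimes> y [^] (0::int)"
    "a \<otimes> a = x [^] (1::int) \<otimes> y [^] (0::int)"
    "(y \<otimes> a) \<otimes> a = x [^] (1::int) \<otimes> y [^] (1::int)"
    "a \<otimes> (y \<otimes> a) = x [^] (1::int) \<otimes> y [^] (-1::int)"
    using core_products by (simp_all add: int_pow_neg)
  note cores = left_core_def right_core_def
  have shift: "bxb (i + 1) w (j - 1) = bxb i (- w) j" "bxb (i - 1) w (j + 1) = bxb i (- w) j" for w
    using bxb_shift[of i w "j - 1"] bxb_shift[of "i - 1" "- w" j] by simp_all
  from e f show ?thesis
  proof (cases rule: core_exchange)
    case (swap e' f')
    from swap(4) obtain t where t: "\<phi> e' t \<noteq> \<phi> e t" by (auto simp: fun_eq_iff)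
    have "(b [^] i \<otimes> x [^] u \<otimes> e') \<otimes> (f' \<otimes> x [^] v \<otimes> b [^] j) =
        b [^] i \<otimes> x [^] u \<otimes> (e' \<otimes> f') \<otimes> x [^] v \<otimes> b [^] j"
      using swap(1,2) by (simp add: m_assoc left_core_closed right_core_closed)
    also have "\<dots> = b [^] i \<otimes> x [^] u \<otimes> (e \<otimes> f) \<otimes> x [^] v \<otimes> b [^] j"
      by (simp only: swap(3))
    also have "\<dots> = \<alpha> \<otimes> \<beta>" by (simp add: \<alpha> \<beta> m_assoc)
    finally show ?thesis using u i v j swap t by (intro alternative[of u i e' v j f' t]) auto
  next
    case one
    have \<alpha>\<beta>: "\<alpha> \<otimes> \<beta> = bxb i (u + v) j"
      using factors_mult[OF _ _ p(1), of i u v j] by (simp add: \<alpha> \<beta> one)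
    \<comment> \<open>If \<open>u \<noteq> v\<close>, then \<open>w = -1\<close> arises from \<open>u = v = -1\<close> and \<open>x\<close>. The one of \<open>u\<close>, \<open>v\<close> that drops
      to \<open>-1\<close> shifts its exponent range by one, so the end of the range has to be wrapped by \<open>m\<close>.\<close>
    consider "u = 0" "v = 0" | "u = -1" "v = -1"
      | "u = 0" "v = -1" "0 < i" | "u = 0" "v = -1" "i = 0"
      | "u = -1" "v = 0" "j < int m" | "u = -1" "v = 0" "j = int m"
      using u v i j by force
    then show ?thesis
    proof cases
      case a: 1
      show ?thesis
        by (rule exch[OF p(2), of "-1" "i + 1" "-1" "j - 1" 0])
          (use a one i j m_ge in \<open>simp_all add: cores \<alpha>\<beta> shift \<phi>_mult \<phi>_x \<phi>_y \<phi>_one\<close>)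
    next
      case a: 2
      show ?thesis
        by (rule exch[OF p(2), of 0 "i - 1" 0 "j + 1" 0])
          (use a one i j m_ge in \<open>simp_all add: cores \<alpha>\<beta> shift \<phi>_mult \<phi>_x \<phi>_y \<phi>_one\<close>)
    next
      case a: 3
      show ?thesis
        by (rule exch[OF p(3), of "-1" i "-1" j 1])
          (use a one i j m_ge in \<open>simp_all add: cores \<alpha>\<beta> \<phi>_a \<phi>_one\<close>)
    next
      case a: 4
      show ?thesis
        by (rule exch[OF p(5), of "-1" "int m" "-1" j "int m"])
          (use a one i j m_ge bxb_wrap[of 0 "-1" "j - int m"] in \<open>simp_all add: cores \<alpha>\<beta> \<phi>_a \<phi>_one\<close>)
    next
      case a: 5
      show ?thesis
        by (rule exch[OF p(3), of "-1" i "-1" j 1])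
          (use a one i j m_ge in \<open>simp_all add: cores \<alpha>\<beta> \<phi>_a \<phi>_one\<close>)
    next
      case a: 6
      show ?thesis
        by (rule exch[OF p(4), of "-1" i "-1" 0 "int m"])
          (use a one i j m_ge in \<open>simp_all add: cores \<alpha>\<beta> \<phi>_a \<phi>_y \<phi>_mult \<phi>_one\<close>)
    qed
  next
    case square
    have \<alpha>\<beta>: "\<alpha> \<otimes> \<beta> = bxb i (u + 2 + v) j"
      using factors_mult[OF _ _ p(2), of i u v j] by (simp add: \<alpha> \<beta> square)
    \<comment> \<open>If \<open>u \<noteq> v\<close>, then \<open>w = 1\<close> arises from \<open>u = v = 0\<close> and \<open>x\<close>. Here the one that rises to \<open>0\<close> may
      have to be wrapped.\<close>
    consider "u = 0" "v = 0" | "u = -1" "v = -1"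
      | "u = 0" "v = -1" "0 < j" | "u = 0" "v = -1" "j = 0"
      | "u = -1" "v = 0" "i < int m" | "u = -1" "v = 0" "i = int m"
      using u v i j by force
    then show ?thesis
    proof cases
      case a: 1
      show ?thesis
        by (rule exch[OF p(1), of "-1" "i + 1" "-1" "j - 1" 0])
          (use a square i j m_ge in \<open>simp_all add: cores \<alpha>\<beta> shift \<phi>_mult \<phi>_x \<phi>_y \<phi>_one\<close>)
    next
      case a: 2
      show ?thesis
        by (rule exch[OF p(1), of 0 "i - 1" 0 "j + 1" 0])
          (use a square i j m_ge in \<open>simp_all add: cores \<alpha>\<beta> shift \<phi>_mult \<phi>_x \<phi>_y \<phi>_one\<close>)
    next
      case a: 3
      show ?thesis
        by (rule exch[OF p(3), of 0 i 0 j 0])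
          (use a square i j m_ge in \<open>simp_all add: cores \<alpha>\<beta> \<phi>_mult \<phi>_x \<phi>_y \<phi>_a\<close>)
    next
      case a: 4
      show ?thesis
        by (rule exch[OF p(5), of 0 i 0 "int m" 0])
          (use a square i j m_ge in \<open>simp_all add: cores \<alpha>\<beta> \<phi>_mult \<phi>_x \<phi>_y \<phi>_a\<close>)
    next
      case a: 5
      show ?thesis
        by (rule exch[OF p(3), of 0 i 0 j 0])
          (use a square i j m_ge in \<open>simp_all add: cores \<alpha>\<beta> \<phi>_mult \<phi>_x \<phi>_y \<phi>_a\<close>)
    next
      case a: 6
      show ?thesis
        by (rule exch[OF p(4), of 0 0 0 j 0])
          (use a square i j m_ge bxb_wrap[of 0 1 j] in
            \<open>simp_all add: cores \<alpha>\<beta> \<phi>_mult \<phi>_x \<phi>_y \<phi>_a\<close>)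
    qed
  qed
qed

lemma large_non_unique_product_set: "\<exists>S. non_unique_product_set G S \<and> N \<le> card S"
proof -
  define Z where "Z = (\<lambda>n. b [^] n) ` {..N}"
  have "inj_on (\<lambda>n::nat. b [^] n) {..N}"
  proof (rule inj_onI)
    fix n n' :: nat
    assume "b [^] n = b [^] n'"
    then have "\<phi> (b [^] int n) 0 = \<phi> (b [^] int n') 0" by (simp add: int_pow_int)
    then show "n = n'" by (simp add: \<phi>_b_pow)
  qed
  then have "card Z = N + 1" by (simp add: Z_def card_image)
  moreover have "\<exists>S. non_unique_product_set G S \<and> card Z \<le> card S"
    using left_factor_closed left_factor_finite factors_nonempty(1)
      right_factor_closed right_factor_finite factors_nonempty(2) _ _ _ factor_exchange
    by (rule non_unique_product_set_sandwich) (auto simp: Z_def)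
  ultimately show ?thesis by (metis add_leD1)
qed

end

section \<open>The presented groups\<close>

text \<open>
  The universal property of a presentation: the kernel of \<open>h\<close> is a normal subgroup containing \<open>R\<close>, hence
  contains the normal closure, and \<open>h\<close> is constant on its cosets.
\<close>

lemma (in group_hom) lift_normal_closure:
  assumes R: "R \<subseteq> kernel G H h"
  obtains \<phi> where "\<phi> \<in> hom (G Mod normal_closure G R) H"
    and "\<And>g. g \<in> carrier G \<Longrightarrow> \<phi> (normal_closure G R #> g) = h g"
proof -
  define N where "N = normal_closure G R"
  have "R \<subseteq> carrier G" using R by (auto simp: kernel_def)
  then interpret N: normal N G unfolding N_def by (rule G.normal_normal_closure)
  have ker: "N \<subseteq> kernel G H h"
    unfolding N_def normal_closure_def using R normal_kernel by blast
  define \<phi> where "\<phi> C = h (SOME g. g \<in> C)" for C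
  have \<phi>: "\<phi> (N #> g) = h g" if g: "g \<in> carrier G" for g
  proof -
    have "(SOME g'. g' \<in> N #> g) \<in> N #> g"
      using G.rcos_self[OF g N.subgroup_axioms] by (rule someI)
    then obtain n where n: "n \<in> N" "(SOME g'. g' \<in> N #> g) = n \<otimes> g"
      by (auto simp: r_coset_def)
    have "n \<in> carrier G" "h n = \<one>\<^bsub>H\<^esub>" using n(1) ker by (auto simp: kernel_def)
    then show ?thesis using g by (simp add: \<phi>_def n(2))
  qed
  have "\<phi> \<in> hom (G Mod N) H"
  proof (rule homI)
    fix C assume "C \<in> carrier (G Mod N)"
    then show "\<phi> C \<in> carrier H" by (auto simp: FactGroup_def RCOSETS_def \<phi>)
  next
    fix C D assume "C \<in> carrier (G Mod N)" "D \<in> carrier (G Mod N)"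
    then obtain g g' where "C = N #> g" "D = N #> g'" "g \<in> carrier G" "g' \<in> carrier G"
      by (auto simp: FactGroup_def RCOSETS_def)
    then show "\<phi> (C \<otimes>\<^bsub>G Mod N\<^esub> D) = \<phi> C \<otimes>\<^bsub>H\<^esub> \<phi> D"
      by (simp add: FactGroup_def N.rcos_sum \<phi>)
  qed
  then show thesis using \<phi> that unfolding N_def by blast
qed

text \<open>
  Let \<open>a\<close> act on the integers as \<open>t \<mapsto> - t\<close> and \<open>b\<close> as \<open>t \<mapsto> t + 1\<close>. As \<open>a\<close> acts as an involution, the first
  relator acts as the square of \<open>a b ^ m\<close>, which is a reflection; the second one acts trivially
  together with \<open>a\<^sup>2\<close>.
\<close>

lemma P_klein_amalgam:
  assumes "k > 0"
  obtains a b \<phi> where "klein_amalgam (P k) a b (2 ^ k) \<phi>"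
proof -
  define a b where "a = (free_gen A :: gen word set)" and "b = (free_gen B :: gen word set)"
  interpret F: group "free_group :: gen word set monoid" by (rule group_free_group)
  define R where "R = {a \<otimes>\<^bsub>free_group\<^esub> b [^]\<^bsub>free_group\<^esub> ((2::nat) ^ k) \<otimes>\<^bsub>free_group\<^esub>
      inv\<^bsub>free_group\<^esub> a \<otimes>\<^bsub>free_group\<^esub> b [^]\<^bsub>free_group\<^esub> ((2::nat) ^ k),
    b \<otimes>\<^bsub>free_group\<^esub> a [^]\<^bsub>free_group\<^esub> (2::nat) \<otimes>\<^bsub>free_group\<^esub> inv\<^bsub>free_group\<^esub> b \<otimes>\<^bsub>free_group\<^esub>
      a [^]\<^bsub>free_group\<^esub> (2::nat)}"
  define N where "N = normal_closure free_group R"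
  have P: "P k = free_group Mod N"
    by (simp add: P_def Let_def presented_group_def N_def R_def a_def b_def)
  have [simp]: "a \<in> carrier free_group" "b \<in> carrier free_group"
    by (simp_all add: a_def b_def free_gen_closed)
  have R: "R \<subseteq> carrier free_group" by (auto simp: R_def)
  interpret N: normal N free_group unfolding N_def by (rule F.normal_normal_closure[OF R])
  interpret P: group "P k" by (rule group_P)
  interpret \<pi>: group_hom free_group "P k" "\<lambda>g. N #>\<^bsub>free_group\<^esub> g"
    by unfold_locales (simp add: P N.r_coset_hom_Mod)
  have R_N: "r \<in> N" if "r \<in> R" for r
    using that by (auto simp: N_def normal_closure_def)
  have relator: "N #>\<^bsub>free_group\<^esub> r = \<one>\<^bsub>P k\<^esub>" if "r \<in> R" for r
    using N.rcos_const[OF F.group_axioms R_N[OF that]] by (simp add: P FactGroup_def)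
  interpret T: group "BijGroup (UNIV :: int set)" by (rule group_BijGroup)
  have T_mult: "f \<otimes>\<^bsub>BijGroup UNIV\<^esub> g = f \<circ> g"
    if "f \<in> carrier (BijGroup UNIV)" "g \<in> carrier (BijGroup UNIV)" for f g :: "int \<Rightarrow> int"
    using that by (simp add: BijGroup_def compose_def comp_def restrict_def)
  have T_one: "\<one>\<^bsub>BijGroup UNIV\<^esub> = (id :: int \<Rightarrow> int)" by (auto simp: BijGroup_def)
  have T_carrier: "f \<in> carrier (BijGroup UNIV) \<longleftrightarrow> bij f" for f :: "int \<Rightarrow> int"
    by (simp add: BijGroup_def Bij_def)
  have T_comp: "f \<circ> g \<in> carrier (BijGroup UNIV)"
    if "f \<in> carrier (BijGroup UNIV)" "g \<in> carrier (BijGroup UNIV)" for f g :: "int \<Rightarrow> int"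
    using that by (simp add: T_carrier bij_comp)
  define refl transl where "refl = (\<lambda>t::int. - t)" and "transl = (\<lambda>t::int. t + 1)"
  have [simp]: "refl \<in> carrier (BijGroup UNIV)" "transl \<in> carrier (BijGroup UNIV)"
    unfolding T_carrier refl_def transl_def
    by (rule o_bij[where g = uminus], auto, rule o_bij[where g = "\<lambda>t. t - 1"], auto)
  have "range (\<lambda>z. case z of A \<Rightarrow> refl | B \<Rightarrow> transl) \<subseteq> carrier (BijGroup UNIV)"
    by (auto split: gen.split)
  then obtain h where h: "h \<in> hom free_group (BijGroup UNIV)"
    "\<And>z. h (free_gen z) = (case z of A \<Rightarrow> refl | B \<Rightarrow> transl)"
    by (rule T.free_group_lift) (rule that)
  interpret h: group_hom free_group "BijGroup (UNIV :: int set)" h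
    by unfold_locales (rule h(1))
  have ha: "h a = refl" and hb: "h b = transl" by (simp_all add: a_def b_def h(2))
  have pow: "transl [^]\<^bsub>BijGroup UNIV\<^esub> n = (\<lambda>t. t + int n)" for n :: nat
  proof (induction n)
    case 0
    then show ?case by (auto simp: T_one)
  next
    case (Suc n)
    have "transl [^]\<^bsub>BijGroup UNIV\<^esub> Suc n = transl [^]\<^bsub>BijGroup UNIV\<^esub> n \<circ> transl"
      by (simp add: T_mult)
    then show ?case unfolding Suc.IH by (auto simp: transl_def)
  qed
  have refl2: "refl \<otimes>\<^bsub>BijGroup UNIV\<^esub> refl = \<one>\<^bsub>BijGroup UNIV\<^esub>"
    by (simp add: T_mult T_one) (auto simp: refl_def)
  have inv_refl: "inv\<^bsub>BijGroup UNIV\<^esub> refl = refl"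
    using refl2 by (intro T.inv_equality) auto
  have "R \<subseteq> kernel free_group (BijGroup UNIV) h"
  proof
    fix r assume r: "r \<in> R"
    have involution: "refl \<otimes>\<^bsub>BijGroup UNIV\<^esub> transl [^]\<^bsub>BijGroup UNIV\<^esub> n \<otimes>\<^bsub>BijGroup UNIV\<^esub>
        refl \<otimes>\<^bsub>BijGroup UNIV\<^esub> transl [^]\<^bsub>BijGroup UNIV\<^esub> n = \<one>\<^bsub>BijGroup UNIV\<^esub>" for n :: nat
    proof -
      have "refl \<circ> transl [^]\<^bsub>BijGroup UNIV\<^esub> n \<circ> refl \<circ> transl [^]\<^bsub>BijGroup UNIV\<^esub> n = id"
        unfolding pow by (auto simp: refl_def)
      then show ?thesis by (simp add: T_mult T_one T_comp)
    qed
    have trivial_square: "refl [^]\<^bsub>BijGroup UNIV\<^esub> (2::nat) = \<one>\<^bsub>BijGroup UNIV\<^esub>"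
      using refl2 by (simp add: numeral_2_eq_2)
    have "h r = \<one>\<^bsub>BijGroup UNIV\<^esub>"
      using r involution trivial_square unfolding R_def
      by (auto simp: h.hom_nat_pow ha hb inv_refl)
    then show "r \<in> kernel free_group (BijGroup UNIV) h"
      using r R by (auto simp: kernel_def)
  qed
  then obtain \<phi> where \<phi>: "\<phi> \<in> hom (P k) (BijGroup UNIV)"
    "\<And>g. g \<in> carrier free_group \<Longrightarrow> \<phi> (N #>\<^bsub>free_group\<^esub> g) = h g"
    using h.lift_normal_closure unfolding P N_def by blast
  let ?a = "N #>\<^bsub>free_group\<^esub> a" and ?b = "N #>\<^bsub>free_group\<^esub> b"
  have "klein_amalgam (P k) ?a ?b (2 ^ k) \<phi>"
  proof unfold_locales
    show "?a \<in> carrier (P k)" "?b \<in> carrier (P k)" by simp_all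
    show "even ((2::nat) ^ k)" using assms by simp
    show "2 \<le> (2::nat) ^ k" using assms by (cases k) auto
    show "?a \<otimes>\<^bsub>P k\<^esub> ?b [^]\<^bsub>P k\<^esub> (2::nat) ^ k \<otimes>\<^bsub>P k\<^esub> inv\<^bsub>P k\<^esub> ?a \<otimes>\<^bsub>P k\<^esub> ?b [^]\<^bsub>P k\<^esub> (2::nat) ^ k = \<one>\<^bsub>P k\<^esub>"
      using relator[of "a \<otimes>\<^bsub>free_group\<^esub> b [^]\<^bsub>free_group\<^esub> ((2::nat) ^ k) \<otimes>\<^bsub>free_group\<^esub>
        inv\<^bsub>free_group\<^esub> a \<otimes>\<^bsub>free_group\<^esub> b [^]\<^bsub>free_group\<^esub> ((2::nat) ^ k)"]
      by (simp add: R_def \<pi>.hom_nat_pow)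
    show "?b \<otimes>\<^bsub>P k\<^esub> ?a [^]\<^bsub>P k\<^esub> (2::nat) \<otimes>\<^bsub>P k\<^esub> inv\<^bsub>P k\<^esub> ?b \<otimes>\<^bsub>P k\<^esub> ?a [^]\<^bsub>P k\<^esub> (2::nat) = \<one>\<^bsub>P k\<^esub>"
      using relator[of "b \<otimes>\<^bsub>free_group\<^esub> a [^]\<^bsub>free_group\<^esub> (2::nat) \<otimes>\<^bsub>free_group\<^esub>
        inv\<^bsub>free_group\<^esub> b \<otimes>\<^bsub>free_group\<^esub> a [^]\<^bsub>free_group\<^esub> (2::nat)"]
      by (simp add: R_def \<pi>.hom_nat_pow)
    show "\<phi> (g \<otimes>\<^bsub>P k\<^esub> g') = \<phi> g \<circ> \<phi> g'" if "g \<in> carrier (P k)" "g' \<in> carrier (P k)" for g g'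
      using that \<phi>(1) by (simp add: hom_mult T_mult hom_in_carrier)
    show "\<phi> ?a = (\<lambda>t. - t)" "\<phi> ?b = (\<lambda>t. t + 1)"
      by (simp_all add: \<phi>(2) ha hb refl_def transl_def)
  qed
  then show thesis by (rule that)
qed

theorem theorem3:
  fixes k N :: nat
  assumes "k > 0"
  shows "\<exists>S. non_unique_product_set (P k) S \<and> card S \<ge> N"
proof -
  obtain a b \<phi> where "klein_amalgam (P k) a b (2 ^ k) \<phi>"
    using P_klein_amalgam[OF assms] .
  then show ?thesis by (rule klein_amalgam.large_non_unique_product_set)
qed

end
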